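(* For every $d\geq 2$ and every integer $k\in[0,d-1]$, there exists a $d$-dimensional 0-1 matrix $P$ such that $\operatorname{ssat}(n,P,d)=\Theta(n^k)$.
   Context: A $d$-dimensional 0-1 matrix $A$ contains a $d$-dimensional 0-1 matrix $P$ if $A$ has a submatrix (obtained by restricting each of the $d$ coordinates to a subset of its range) of the same dimensions as $P$, called a copy of $P$, that can be turned into $P$ by changing any number of $1$-entries to $0$-entries. A matrix $A$ is $P$-semisaturated if changing any $0$-entry of $A$ to a $1$-entry introduces a new copy of $P$ (i.e. a copy in which the changed entry plays the role of a $1$-entry of $P$); $A$ is not required to avoid $P$. $\operatorname{ssat}(n,P,d)$ is the minimum possible number of $1$-entries in a $P$-semisaturated $d$-dimensional $n\times\dots\times n$ 0-1 matrix. Asymptotics are for $n\to\infty$ with $P$ and $d$ fixed. *)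

theory Defs
  imports Complex_Main "HOL-Library.Landau_Symbols"
begin

text \<open>
  A multidimensional 0-1 matrix is given by the list of its side lengths and the set of
  positions of its 1-entries. Positions are lists of 0-based coordinates.
\<close>

datatype mat01 = Mat01 (dims: "nat list") (ones: "nat list set")

definition positions :: "nat list \<Rightarrow> nat list set" where
  "positions ns = {x. length x = length ns \<and> (\<forall>i<length ns. x ! i < ns ! i)}"

definition is_mat01 :: "nat \<Rightarrow> mat01 \<Rightarrow> bool" where
  "is_mat01 d A \<longleftrightarrow>
     length (dims A) = d \<and> (\<forall>m\<in>set (dims A). 0 < m) \<and> ones A \<subseteq> positions (dims A)"

definition selects :: "nat set list \<Rightarrow> mat01 \<Rightarrow> bool" where
  "selects S A \<longleftrightarrow>
     length S = length (dims A) \<and> (\<forall>i<length S. S ! i \<subseteq> {..<dims A ! i})"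

text \<open>
  The position in the ambient matrix of the entry at position \<open>y\<close> of the submatrix
  selected by \<open>S\<close>: its \<open>i\<close>-th coordinate is the element of \<open>S ! i\<close> with exactly
  \<open>y ! i\<close> smaller elements in \<open>S ! i\<close>.
\<close>

definition lift_pos :: "nat set list \<Rightarrow> nat list \<Rightarrow> nat list" where
  "lift_pos S y = map (\<lambda>i. sorted_list_of_set (S ! i) ! (y ! i)) [0..<length S]"

definition submat :: "nat set list \<Rightarrow> mat01 \<Rightarrow> mat01" where
  "submat S A =
     Mat01 (map card S) {y \<in> positions (map card S). lift_pos S y \<in> ones A}"

definition is_copy :: "mat01 \<Rightarrow> mat01 \<Rightarrow> nat set list \<Rightarrow> bool" where
  "is_copy P A S \<longleftrightarrow>
     selects S A \<and> dims (submat S A) = dims P \<and> ones P \<subseteq> ones (submat S A)"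

definition set_one :: "nat list \<Rightarrow> mat01 \<Rightarrow> mat01" where
  "set_one x A = Mat01 (dims A) (insert x (ones A))"

definition semisaturated :: "mat01 \<Rightarrow> mat01 \<Rightarrow> bool" where
  "semisaturated P A \<longleftrightarrow>
     (\<forall>x \<in> positions (dims A) - ones A.
        \<exists>S. is_copy P (set_one x A) S \<and> (\<exists>y\<in>ones P. lift_pos S y = x))"

text \<open>
  For \<open>n > 0\<close> the infimum is a minimum, since the all-ones matrix is semisaturated.
\<close>

definition ssat :: "nat \<Rightarrow> mat01 \<Rightarrow> nat \<Rightarrow> nat" where
  "ssat n P d =
     Inf {card (ones A) |A. is_mat01 d A \<and> dims A = replicate d n \<and> semisaturated P A}"

end

theory Submission imports Defs "HOL-Library.FuncSet" begin

text \<open>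
  Fix a large box of side \<open>M\<close>. For every face of the box of dimension greater than \<open>k\<close>, the
  pattern \<open>P\<close> has one 1-entry inside that face, and the entries of different faces have different
  coordinates in all their free directions. A matrix whose 1-entries are the positions with at most
  \<open>k\<close> coordinates farther than \<open>M\<close> from the ends has \<open>O(n\<^sup>k)\<close> 1-entries and is
  semisaturated: a 0-entry lies deep inside some face of dimension greater than \<open>k\<close>, so let it
  play the role of the 1-entry of \<open>P\<close> in that face and push all other coordinates of the copy to
  the ends. Conversely, no 1-entry of \<open>P\<close> lies in a face of dimension \<open>k\<close>, hence a
  \<open>k\<close>-face of a semisaturated matrix consists of 1-entries only.
\<close>

section \<open>Counting coordinatewise sets of lists, and sorted enumerations\<close>

lemma positions_replicate:
  "positions (replicate d n) = {x. length x = d \<and> (\<forall>i<d. x ! i < n)}"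
  by (auto simp: positions_def)

lemma bij_betw_PiE_lists:
  "bij_betw (\<lambda>f. map f [0..<d]) (PiE {..<d} B) {x. length x = d \<and> (\<forall>i<d. x ! i \<in> B i)}"
\<comment> \<open>Functions in \<open>PiE\<close> are extensional, so the inverse has to return
  \<open>undefined\<close> off \<open>{..<d}\<close>.\<close>
proof (rule bij_betw_byWitness[where f' = "\<lambda>x i. if i < d then x ! i else undefined"])
  show "\<forall>f\<in>PiE {..<d} B. (\<lambda>i. if i < d then map f [0..<d] ! i else undefined) = f"
    by (auto simp: fun_eq_iff PiE_def extensional_def)
  show "\<forall>x\<in>{x. length x = d \<and> (\<forall>i<d. x ! i \<in> B i)}.
      map (\<lambda>i. if i < d then x ! i else undefined) [0..<d] = x"
    by (auto intro!: nth_equalityI)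
qed (auto simp: PiE_def extensional_def)

lemma card_lists_nth_in:
  "card {x. length x = d \<and> (\<forall>i<d. x ! i \<in> B i)} = (\<Prod>i<d. card (B i))"
  using bij_betw_same_card[OF bij_betw_PiE_lists[of d B]] by (simp add: card_PiE)

lemma finite_lists_nth_in:
  assumes "\<And>i. i < d \<Longrightarrow> finite (B i)"
  shows "finite {x. length x = d \<and> (\<forall>i<d. x ! i \<in> B i)}"
proof -
  have "finite (PiE {..<d} B)" using assms by (intro finite_PiE) auto
  then show ?thesis using bij_betw_finite[OF bij_betw_PiE_lists[of d B]] by blast
qed

lemma finite_positions: "finite (positions (replicate d n))"
  using finite_lists_nth_in[of d "\<lambda>_. {..<n}"] by (simp add: positions_replicate)

text \<open>Allows a copy to be given by increasing row maps: if each selected set is the image of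
  such a map, \<open>lift_pos\<close> applies these maps coordinatewise.\<close>

lemma nth_sorted_list_of_image:
  fixes f :: "nat \<Rightarrow> 'a::linorder"
  assumes "strict_mono_on {..<M} f" "j < M"
  shows "sorted_list_of_set (f ` {..<M}) ! j = f j"
proof -
  have "sorted_wrt (<) (map f [0..<M])"
    using assms(1) by (auto simp: sorted_wrt_iff_nth_less strict_mono_on_def)
  then have "sorted_list_of_set (set (map f [0..<M])) = map f [0..<M]"
    by (metis sorted_list_of_set.idem_if_sorted_distinct strict_sorted_iff)
  then have "sorted_list_of_set (f ` {..<M}) = map f [0..<M]"
    by (simp add: atLeast0LessThan)
  then show ?thesis using assms(2) by simp
qed

text \<open>For the lower bound: only the first row of a copy can land in row 0 of the ambient
  matrix.\<close>

lemma nth_sorted_list_of_set_pos: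
  fixes T :: "nat set"
  assumes "0 < j" "j < card T"
  shows "0 < sorted_list_of_set T ! j"
proof -
  have "sorted_list_of_set T ! 0 < sorted_list_of_set T ! j"
    using assms strict_sorted_list_of_set[of T] by (auto simp: sorted_wrt_iff_nth_less)
  then show ?thesis by simp
qed

lemma prod_power_on_subset:
  fixes a :: "'a::comm_monoid_mult" and d :: nat
  assumes "J \<subseteq> {..<d}"
  shows "(\<Prod>i<d. if i \<in> J then a else 1) = a ^ card J"
  using prod.inter_restrict[of "{..<d}" "\<lambda>_. a" J] assms by (simp add: Int_absorb1)

text \<open>
  A face is coded by a list over \<open>{0, 1, 2}\<close>: coordinates fixed at the lower end, free
  coordinates, and coordinates fixed at the upper end.
\<close>

definition face_codes :: "nat \<Rightarrow> nat \<Rightarrow> nat list set" where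
  "face_codes d k = {s \<in> positions (replicate d 3). k < card {i. i < d \<and> s ! i = 1}}"

text \<open>The pattern has side \<open>m + 2\<close>. Coordinates \<open>0\<close> and
  \<open>m + 1\<close> are its ends; the label \<open>h s\<close>, taken from 1 to \<open>m\<close>,
  is repeated in every free direction and keeps the entry inside its face.\<close>

definition face_pos :: "nat \<Rightarrow> (nat list \<Rightarrow> nat) \<Rightarrow> nat list \<Rightarrow> nat list" where
  "face_pos m h s = map (\<lambda>c. if c = 0 then 0 else if c = 1 then h s else m + 1) s"

definition face_pattern :: "nat \<Rightarrow> nat \<Rightarrow> nat \<Rightarrow> (nat list \<Rightarrow> nat) \<Rightarrow> mat01" where
  "face_pattern d k m h = Mat01 (replicate d (m + 2)) (face_pos m h ` face_codes d k)"

definition inner_coords :: "nat \<Rightarrow> nat \<Rightarrow> nat \<Rightarrow> nat list \<Rightarrow> nat set" where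
  "inner_coords n M d x = {i. i < d \<and> M \<le> x ! i \<and> x ! i < n - M}"

definition skeleton :: "nat \<Rightarrow> nat \<Rightarrow> nat \<Rightarrow> nat \<Rightarrow> mat01" where
  "skeleton n M d k =
     Mat01 (replicate d n) {x \<in> positions (replicate d n). card (inner_coords n M d x) \<le> k}"

lemma is_mat01_face_pattern:
  assumes "\<And>s. s \<in> face_codes d k \<Longrightarrow> 1 \<le> h s \<and> h s \<le> m"
  shows "is_mat01 d (face_pattern d k m h)"
  using assms
  by (fastforce simp: is_mat01_def face_pattern_def face_codes_def positions_replicate face_pos_def)

section \<open>Upper bound: size and semisaturation of the skeleton\<close>

lemma card_ones_skeleton_le:
  assumes "0 < M" "0 < n"
  shows "card (ones (skeleton n M d k)) \<le> 2 ^ d * (2 * M) ^ d * n ^ k"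
proof -
  \<comment> \<open>Union bound over the set \<open>J\<close> of inner coordinates: those in
    \<open>J\<close> range over \<open>n\<close> values, the others over the two end strips of width
    \<open>M\<close>.\<close>
  define B where "B J i = (if i \<in> J then {..<n} else {..<M} \<union> {n - M..<n})" for J and i :: nat
  define X where "X J = {x. length x = d \<and> (\<forall>i<d. x ! i \<in> B J i)}" for J
  define \<J> where "\<J> = {J. J \<subseteq> {..<d} \<and> card J \<le> k}"
  have fin: "finite \<J>" unfolding \<J>_def by (rule finite_subset[of _ "Pow {..<d}"]) auto
  have "card \<J> \<le> card (Pow {..<d})"
    by (rule card_mono) (auto simp: \<J>_def)
  then have cJ: "card \<J> \<le> 2 ^ d" by (simp add: card_Pow)
  have cX: "card (X J) \<le> (2 * M) ^ d * n ^ k" if "J \<in> \<J>" for J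
  proof -
    have "card (X J) = (\<Prod>i<d. card (B J i))"
      unfolding X_def by (rule card_lists_nth_in)
    \<comment> \<open>Coordinates in \<open>J\<close> are granted the factor \<open>2 * M\<close>
      too, which makes the constant independent of \<open>J\<close>.\<close>
    also have "\<dots> \<le> (\<Prod>i<d. (2 * M) * (if i \<in> J then n else 1))"
    proof (rule prod_mono)
      fix i
      have "card ({..<M} \<union> {n - M..<n}) \<le> 2 * M"
        using card_Un_le[of "{..<M}" "{n - M..<n}"] by simp
      then show "0 \<le> card (B J i) \<and> card (B J i) \<le> (2 * M) * (if i \<in> J then n else 1)"
        using assms by (auto simp: B_def)
    qed
    also have "\<dots> = (2 * M) ^ d * (\<Prod>i<d. if i \<in> J then n else 1)"
      by (simp add: prod.distrib power_mult_distrib)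
    also have "(\<Prod>i<d. if i \<in> J then n else 1) = n ^ card J"
      using that by (intro prod_power_on_subset) (simp add: \<J>_def)
    also have "n ^ card J \<le> n ^ k"
      using that assms by (intro power_increasing) (auto simp: \<J>_def)
    finally show ?thesis by simp
  qed
  have "ones (skeleton n M d k) \<subseteq> (\<Union>J\<in>\<J>. X J)"
  proof
    fix x assume "x \<in> ones (skeleton n M d k)"
    then have "inner_coords n M d x \<in> \<J>" "x \<in> X (inner_coords n M d x)"
      by (auto simp: skeleton_def \<J>_def X_def B_def positions_replicate inner_coords_def)
    then show "x \<in> (\<Union>J\<in>\<J>. X J)" by blast
  qed
  moreover have "finite (\<Union>J\<in>\<J>. X J)"
  proof (rule finite_UN_I[OF fin])
    show "finite (X J)" for J
      unfolding X_def by (rule finite_lists_nth_in) (simp add: B_def)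
  qed
  ultimately have "card (ones (skeleton n M d k)) \<le> card (\<Union>J\<in>\<J>. X J)"
    by (rule card_mono[rotated])
  also have "\<dots> \<le> (\<Sum>J\<in>\<J>. card (X J))" by (rule card_UN_le[OF fin])
  also have "\<dots> \<le> card \<J> * ((2 * M) ^ d * n ^ k)"
    using sum_bounded_above[of \<J> "\<lambda>J. card (X J)"] cX by simp
  also have "\<dots> \<le> 2 ^ d * ((2 * M) ^ d * n ^ k)"
    using cJ by (intro mult_right_mono) auto
  finally show ?thesis by (simp add: mult.assoc)
qed

lemma semisaturated_skeleton:
  assumes inj: "inj_on h (face_codes d k)"
    and h: "\<And>s. s \<in> face_codes d k \<Longrightarrow> 1 \<le> h s \<and> h s \<le> m"
    and M: "M = m + 2" and n: "2 * M \<le> n"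
  shows "semisaturated (face_pattern d k m h) (skeleton n M d k)"
  unfolding semisaturated_def
proof
  let ?A = "skeleton n M d k" and ?P = "face_pattern d k m h"
  fix x assume x: "x \<in> positions (dims ?A) - ones ?A"
  then have lx: "length x = d" and xn: "\<And>i. i < d \<Longrightarrow> x ! i < n"
    and deep: "k < card (inner_coords n M d x)"
    by (auto simp: skeleton_def positions_replicate)
  \<comment> \<open>The code of the face in which \<open>x\<close> lies deep; its free directions
    are the inner coordinates of \<open>x\<close>.\<close>
  define s where "s = map (\<lambda>a. if a < M then 0 else if a < n - M then 1 else 2 :: nat) x"
  have ls: "length s = d" by (simp add: s_def lx)
  have "{i. i < d \<and> s ! i = 1} = inner_coords n M d x"
    by (auto simp: s_def lx inner_coords_def split: if_splits)
  then have s: "s \<in> face_codes d k"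
    using deep by (auto simp: face_codes_def positions_replicate s_def lx)
  define y where "y = face_pos m h s"
  have y_nth: "y ! i = (if x ! i < M then 0 else if x ! i < n - M then h s else m + 1)"
    if "i < d" for i
    using that by (simp add: y_def face_pos_def s_def lx)
  have ly: "length y = d" by (simp add: y_def face_pos_def ls)
  have yM: "y ! i < M" if "i < d" for i using h[OF s] that M by (auto simp: y_nth)
  \<comment> \<open>Row \<open>y ! i\<close> of the copy goes to \<open>x ! i\<close>, the rows below and above it to the two ends.\<close>
  define f where "f i j = (if j < y ! i then j else if j = y ! i then x ! i else n - M + j)" for i j
  \<comment> \<open>By \<open>2 * M \<le> n\<close> the end strips are disjoint. If
    \<open>x ! i\<close> lies in one of them, \<open>y ! i\<close> is the corresponding end row of
    the pattern, so no row has to fit between \<open>x ! i\<close> and that end.\<close>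
  have mono: "strict_mono_on {..<M} (f i)" if "i < d" for i
    using h[OF s] n M xn[OF that] by (auto simp: strict_mono_on_def f_def y_nth that)
  have f_less: "f i j < n" if "i < d" "j < M" for i j
    using xn[OF that(1)] that n by (auto simp: f_def)
  define S where "S = map (\<lambda>i. f i ` {..<M}) [0..<d]"
  have lS: "length S = d" by (simp add: S_def)
  have lift: "lift_pos S z = map (\<lambda>i. f i (z ! i)) [0..<d]"
    if "z \<in> positions (replicate d M)" for z
    using that mono
    by (auto simp: lift_pos_def lS S_def positions_replicate nth_sorted_list_of_image)
  have cards: "map card S = replicate d M"
    using mono by (auto intro!: nth_equalityI simp: S_def card_image strict_mono_on_imp_inj_on)
  have yP: "y \<in> positions (replicate d M)"
    using yM ly by (simp add: positions_replicate)
  have lift_y: "lift_pos S y = x"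
    by (auto intro!: nth_equalityI simp: lift[OF yP] f_def lx)
  have "z \<in> positions (replicate d M) \<and> lift_pos S z \<in> insert x (ones ?A)" if "z \<in> ones ?P" for z
  proof -
    from that obtain s' where s': "s' \<in> face_codes d k" and z: "z = face_pos m h s'"
      by (auto simp: face_pattern_def)
    have zP: "z \<in> positions (replicate d M)"
      using is_mat01_face_pattern[of d k h m] h that M
      by (auto simp: is_mat01_def face_pattern_def)
    show ?thesis
    proof (cases "s' = s")
      case True
      then show ?thesis using lift_y zP by (simp add: z y_def)
    next
      case False
      then have ne: "h s' \<noteq> h s" using inj s s' by (auto dest: inj_onD)
      have ls': "length s' = d" using s' by (simp add: face_codes_def positions_replicate)
      have zM: "z ! i < M" if "i < d" for i using zP that by (simp add: positions_replicate)
      \<comment> \<open>Since \<open>h s'\<close> differs from \<open>h s\<close>, the entry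
        \<open>z\<close> can share row \<open>y ! i\<close> only if that is an end row, and then
        \<open>x ! i\<close> is in an end strip. All other rows are sent to the ends, so
        \<open>z\<close> lands on a position without inner coordinates.\<close>
      have "\<not> (M \<le> f i (z ! i) \<and> f i (z ! i) < n - M)" if "i < d" for i
      proof (cases "z ! i = y ! i")
        case True
        have "z ! i \<noteq> h s"
          using ne h[OF s] that by (auto simp: z face_pos_def ls')
        then show ?thesis using True y_nth[OF that] by (auto simp: f_def split: if_splits)
      next
        case False
        then show ?thesis using zM[OF that] by (auto simp: f_def)
      qed
      then have "inner_coords n M d (lift_pos S z) = {}"
        by (auto simp: inner_coords_def lift[OF zP])
      moreover have "lift_pos S z \<in> positions (replicate d n)"
        using f_less zM by (simp add: positions_replicate lift[OF zP])
      ultimately show ?thesis using zP by (simp add: skeleton_def)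
    qed
  qed
  then have "ones ?P \<subseteq> ones (submat S (set_one x ?A))"
    by (auto simp: submat_def set_one_def cards)
  moreover have "selects S (set_one x ?A)"
    using f_less by (auto simp: selects_def set_one_def S_def skeleton_def)
  moreover have "dims (submat S (set_one x ?A)) = dims ?P"
    by (simp add: submat_def cards face_pattern_def M)
  ultimately have "is_copy ?P (set_one x ?A) S" by (simp add: is_copy_def)
  moreover have "y \<in> ones ?P" using s by (simp add: y_def face_pattern_def)
  ultimately show "\<exists>S. is_copy ?P (set_one x ?A) S \<and> (\<exists>y\<in>ones ?P. lift_pos S y = x)"
    using lift_y by blast
qed

section \<open>Lower bound: a full face of dimension \<open>k\<close>\<close>

lemma card_ones_semisaturated_ge:
  assumes A: "is_mat01 d A" "dims A = replicate d n"
    and h: "\<And>s. s \<in> face_codes d k \<Longrightarrow> 1 \<le> h s"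
    and sat: "semisaturated (face_pattern d k m h) A" and n: "0 < n" and k: "k \<le> d"
  shows "n ^ k \<le> card (ones A)"
proof -
  let ?P = "face_pattern d k m h"
  let ?B = "\<lambda>i. if i < k then {..<n} else {0}"
  let ?F = "{x. length x = d \<and> (\<forall>i<d. x ! i \<in> ?B i)}"
  have "?F \<subseteq> ones A"
  proof
    fix x assume x: "x \<in> ?F"
    show "x \<in> ones A"
    proof (rule ccontr)
      assume "x \<notin> ones A"
      moreover have "x \<in> positions (dims A)"
        using x n by (auto simp: A positions_replicate split: if_splits)
      ultimately obtain S y where S: "is_copy ?P (set_one x A) S"
        and y: "y \<in> ones ?P" "lift_pos S y = x"
        using sat unfolding semisaturated_def by blast
      from y(1) obtain s where s: "s \<in> face_codes d k" and ys: "y = face_pos m h s"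
        by (auto simp: face_pattern_def)
      have lS: "length S = d" using S by (simp add: is_copy_def selects_def set_one_def A)
      have "y \<in> positions (map card S)"
        using S y(1) by (auto simp: is_copy_def submat_def)
      then have yc: "y ! i < card (S ! i)" if "i < d" for i
        using that lS by (simp add: positions_def)
      \<comment> \<open>The copy preserves order, so only its first row can meet the face
        \<open>x ! i = 0\<close>.\<close>
      have "y ! i = 0" if "k \<le> i" "i < d" for i
      proof (rule ccontr)
        assume "y ! i \<noteq> 0"
        then have "0 < sorted_list_of_set (S ! i) ! (y ! i)"
          using nth_sorted_list_of_set_pos yc that by simp
        also have "\<dots> = x ! i" using y(2) that lS by (auto simp: lift_pos_def)
        also have "\<dots> = 0" using x that by auto
        finally show False by simp
      qed
      \<comment> \<open>Labels are at least 1, so a zero coordinate of \<open>y\<close> is not a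
        free direction of \<open>s\<close>; fewer than \<open>k + 1\<close> free directions
        remain.\<close>
      then have "{i. i < d \<and> s ! i = 1} \<subseteq> {..<k}"
        using h[OF s] s
        by (force simp: ys face_pos_def face_codes_def positions_replicate not_less[symmetric])
      then have "card {i. i < d \<and> s ! i = 1} \<le> k"
        using card_mono[of "{..<k}"] by fastforce
      then show False using s by (simp add: face_codes_def)
    qed
  qed
  moreover have "finite (ones A)"
    using A finite_subset[OF _ finite_positions] by (auto simp: is_mat01_def)
  ultimately have "card ?F \<le> card (ones A)" by (rule card_mono[rotated])
  moreover have "card ?F = (\<Prod>i<d. if i \<in> {..<k} then n else 1)"
    by (subst card_lists_nth_in) (auto intro!: prod.cong)
  moreover have "\<dots> = n ^ k"
    using prod_power_on_subset[of "{..<k}" d n] k by simp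
  ultimately show ?thesis by simp
qed


section \<open>Choice of the labels and order of growth\<close>

theorem lemma4p5:
  fixes d k :: nat
  assumes "d \<ge> 2" and "k \<le> d - 1"
  shows "\<exists>P. is_mat01 d P \<and> (\<lambda>n. real (ssat n P d)) \<in> \<Theta>(\<lambda>n. real n ^ k)"
proof -
  have fin: "finite (face_codes d k)"
    using finite_positions[of d 3] by (simp add: face_codes_def)
  define m where "m = card (face_codes d k)"
  obtain g where g: "bij_betw g (face_codes d k) {0..<m}"
    using ex_bij_betw_finite_nat[OF fin] m_def by blast
  \<comment> \<open>The shift by one reserves 0 for the lower end.\<close>
  define h where "h = Suc \<circ> g"
  have inj: "inj_on h (face_codes d k)"
    using g by (auto simp: h_def bij_betw_def intro!: comp_inj_on)
  have h: "1 \<le> h s \<and> h s \<le> m" if "s \<in> face_codes d k" for s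
    using bij_betwE[OF g] that by (auto simp: h_def)
  define M where "M = m + 2"
  define P where "P = face_pattern d k m h"
  define C where "C = 2 ^ d * (2 * M) ^ d"
  have bounds: "n ^ k \<le> ssat n P d \<and> ssat n P d \<le> C * n ^ k" if n: "2 * M \<le> n" for n
  proof
    let ?X = "{card (ones A) |A. is_mat01 d A \<and> dims A = replicate d n \<and> semisaturated P A}"
    have n0: "0 < n" using n M_def by simp
    have "is_mat01 d (skeleton n M d k)"
      using n0 by (auto simp: is_mat01_def skeleton_def)
    moreover have "semisaturated P (skeleton n M d k)"
      unfolding P_def using inj h M_def n by (rule semisaturated_skeleton)
    ultimately have mem: "card (ones (skeleton n M d k)) \<in> ?X"
      by (force simp: skeleton_def)
    then have "ssat n P d \<le> card (ones (skeleton n M d k))"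
      unfolding ssat_def by (intro cInf_lower) auto
    also have "\<dots> \<le> C * n ^ k"
      using card_ones_skeleton_le[of M n d k] n0 by (simp add: C_def M_def)
    finally show "ssat n P d \<le> C * n ^ k" .
    \<comment> \<open>The skeleton makes the set nonempty, so the infimum is attained by a
      semisaturated matrix, to which the lower bound applies.\<close>
    have "ssat n P d \<in> ?X"
      unfolding ssat_def using mem by (intro Inf_nat_def1) blast
    then show "n ^ k \<le> ssat n P d"
      using card_ones_semisaturated_ge[of d _ n k h m] h n0 assms by (auto simp: P_def)
  qed
  have "(\<lambda>n. real (ssat n P d)) \<in> \<Theta>(\<lambda>n. real n ^ k)"
  proof (rule bigthetaI)
    have "real (ssat n P d) \<le> real C * real n ^ k" if "2 * M \<le> n" for n
      using bounds[OF that] by (metis of_nat_le_iff of_nat_mult of_nat_power)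
    then show "(\<lambda>n. real (ssat n P d)) \<in> O(\<lambda>n. real n ^ k)"
      by (intro bigoI[of _ "real C"] eventually_mono[OF eventually_ge_at_top[of "2 * M"]]) simp
    have "real n ^ k \<le> real (ssat n P d)" if "2 * M \<le> n" for n
      using bounds[OF that] by (metis of_nat_le_iff of_nat_power)
    then show "(\<lambda>n. real (ssat n P d)) \<in> \<Omega>(\<lambda>n. real n ^ k)"
      by (intro landau_omega.bigI[of 1] eventually_mono[OF eventually_ge_at_top[of "2 * M"]]) simp_all
  qed
  moreover have "is_mat01 d P"
    unfolding P_def using h by (rule is_mat01_face_pattern)
  ultimately show ?thesis by blast
qed

end
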